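(* Let $t_1,t_2\in\bigl(\tfrac12,1\bigr)$ and $p\in\bigl[\tfrac12,\infty\bigr)$. Then the double inequality $$Q_{t_1,p}(a,b)<M(a,b)<Q_{t_2,p}(a,b)$$ holds for all real numbers $a,b>0$ with $a\neq b$ if and only if $$t_1\le\frac12\left[1+\sqrt{\left(\frac1{t^*}\right)^{1/p}-1}\,\right]\quad\text{and}\quad t_2\ge\frac12\left(1+\frac1{\sqrt{6p}}\right),$$ where $t^*=\ln\bigl(1+\sqrt2\,\bigr)$.
   Context: For real numbers $a,b>0$ with $a\ne b$, the Neuman-Sándor mean is $$M(a,b)=\frac{a-b}{2\operatorname{arcsinh}\bigl[(a-b)/(a+b)\bigr]},$$ where $\operatorname{arcsinh}$ is the inverse hyperbolic sine. The contra-harmonic mean is $C(a,b)=\frac{a^2+b^2}{a+b}$ and the arithmetic mean is $A(a,b)=\frac{a+b}2$. For $t\in\bigl(\tfrac12,1\bigr)$ and $p\ge\tfrac12$, $$Q_{t,p}(a,b)=C\bigl(ta+(1-t)b,\;tb+(1-t)a\bigr)^{p}\,A(a,b)^{1-p}$$ (real powers of positive real numbers). *)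

theory Defs
  imports Complex_Main
begin

text \<open>Only positive arguments are intended; the Neuman-Sandor mean is only meant for \<open>a \<noteq> b\<close>
  (at \<open>a = b\<close> the formula is 0/0, which HOL evaluates to 0).\<close>

definition neuman_sandor_mean :: "real \<Rightarrow> real \<Rightarrow> real" where
  "neuman_sandor_mean a b = (a - b) / (2 * arsinh ((a - b) / (a + b)))"

definition contraharmonic_mean :: "real \<Rightarrow> real \<Rightarrow> real" where
  "contraharmonic_mean a b = (a\<^sup>2 + b\<^sup>2) / (a + b)"

definition arithmetic_mean :: "real \<Rightarrow> real \<Rightarrow> real" where
  "arithmetic_mean a b = (a + b) / 2"

definition Q_mean :: "real \<Rightarrow> real \<Rightarrow> real \<Rightarrow> real \<Rightarrow> real" where
  "Q_mean t p a b =
     contraharmonic_mean (t * a + (1 - t) * b) (t * b + (1 - t) * a) powr p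
       * arithmetic_mean a b powr (1 - p)"

definition t_star :: real where
  "t_star = ln (1 + sqrt 2)"

end

theory Submission
  imports Defs "HOL-Analysis.Convex" "HOL-Real_Asymp.Real_Asymp"
begin

text \<open>
  Put \<open>x = \<bar>a - b\<bar> / (a + b)\<close> and \<open>u = (2t - 1)\<^sup>2\<close>. Dividing by the arithmetic mean turns the claim
  into \<open>(1 + u\<^sub>1x\<^sup>2)\<^sup>p < x / arsinh x < (1 + u\<^sub>2x\<^sup>2)\<^sup>p\<close> on \<open>(0, 1)\<close>. Necessity follows by letting
  \<open>x \<rightarrow> 1\<close> on the left and \<open>x \<rightarrow> 0\<close> on the right. For sufficiency, convexity of \<open>z \<mapsto> z\<^sup>2\<^sup>p\<close>
  reduces the extremal values of \<open>u\<^sub>1\<close> and \<open>u\<^sub>2\<close> to the case \<open>p = 1/2\<close>, which compares \<open>arsinh x\<close> with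
  \<open>x / sqrt (1 + ux\<^sup>2)\<close>; the difference of their derivatives has the sign of a polynomial in \<open>x\<^sup>2\<close>.
\<close>

section \<open>Exponent 1/2: comparison of \<open>arsinh x\<close> with
  \<open>x / sqrt (1 + u * x\<^sup>2)\<close>\<close>

lemma has_real_derivative_divide_sqrt:
  fixes u z :: real
  assumes "u \<ge> 0"
  shows "((\<lambda>z. z / sqrt (1 + u * z\<^sup>2)) has_real_derivative 1 / sqrt (1 + u * z\<^sup>2) ^ 3) (at z)"
proof -
  define s where "s = sqrt (1 + u * z\<^sup>2)"
  have pos: "1 + u * z\<^sup>2 > 0" using assms by (simp add: add_pos_nonneg)
  then have s: "s > 0" "s\<^sup>2 = 1 + u * z\<^sup>2" by (simp_all add: s_def)
  have "((\<lambda>z. z / sqrt (1 + u * z\<^sup>2)) has_real_derivative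
      (s - z * (u * (2 * z) * (inverse s / 2))) / (s * s)) (at z)"
    unfolding s_def using pos by (auto intro!: derivative_eq_intros)
  also have "(s - z * (u * (2 * z) * (inverse s / 2))) / (s * s) = (s\<^sup>2 - u * z\<^sup>2) / s ^ 3"
    using s(1) by (simp add: field_simps power2_eq_square power3_eq_cube)
  finally show ?thesis using s(2) by (simp add: s_def)
qed

lemma inverse_sqrt_cube_less_iff:
  fixes r s :: real
  assumes "r > 0" "s > 0"
  shows "1 / sqrt s ^ 3 < 1 / sqrt r \<longleftrightarrow> r < s ^ 3"
    and "1 / sqrt r < 1 / sqrt s ^ 3 \<longleftrightarrow> s ^ 3 < r"
  using assms by (simp_all add: field_simps flip: real_sqrt_power)

lemma has_real_derivative_divide_sqrt_diff_arsinh: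
  fixes u z :: real
  assumes "u \<ge> 0"
  shows "((\<lambda>z. z / sqrt (1 + u * z\<^sup>2) - arsinh z) has_real_derivative
           1 / sqrt (1 + u * z\<^sup>2) ^ 3 - 1 / sqrt (z\<^sup>2 + 1)) (at z)"
  by (intro DERIV_diff has_real_derivative_divide_sqrt assms arsinh_real_has_field_derivative)

text \<open>For \<open>u = 1/3\<close> the linear terms in \<open>y = z\<^sup>2\<close> of
  \<open>(1 + u * y) ^ 3\<close> and \<open>1 + y\<close> agree, and what remains of the cube is
  positive; hence the difference of the two sides decreases from its value 0 at 0.\<close>

lemma divide_sqrt_less_arsinh:
  fixes x :: real
  assumes "x > 0"
  shows "x / sqrt (1 + 1/3 * x\<^sup>2) < arsinh x"
proof -
  define f where "f = (\<lambda>z::real. z / sqrt (1 + 1/3 * z\<^sup>2) - arsinh z)"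
  have "f x < f 0"
  proof (rule DERIV_neg_imp_decreasing_open[OF assms])
    fix z :: real assume "0 < z" "z < x"
    have "(1 + 1/3 * y) ^ 3 = y + 1 + y\<^sup>2 / 3 + y ^ 3 / 27" for y :: real
      by (simp add: power2_eq_square power3_eq_cube field_simps)
    note this[of "z\<^sup>2"]
    moreover have "(z\<^sup>2)\<^sup>2 / 3 + (z\<^sup>2) ^ 3 / 27 > 0"
      using \<open>0 < z\<close> by (simp add: add_pos_pos)
    ultimately have "z\<^sup>2 + 1 < (1 + 1/3 * z\<^sup>2) ^ 3" by linarith
    moreover have "z\<^sup>2 + 1 > 0" by (simp add: add_nonneg_pos)
    moreover have "1 + 1/3 * z\<^sup>2 > 0" by (simp add: add_pos_nonneg)
    ultimately have "1 / sqrt (1 + 1/3 * z\<^sup>2) ^ 3 - 1 / sqrt (z\<^sup>2 + 1) < 0"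
      by (simp only: inverse_sqrt_cube_less_iff diff_less_0_iff_less)
    then show "\<exists>y. (f has_real_derivative y) (at z) \<and> y < 0"
      using has_real_derivative_divide_sqrt_diff_arsinh[of "1/3" z] by (auto simp: f_def)
  next
    show "continuous_on {0..x} f"
      unfolding f_def
      by (rule DERIV_continuous_on, rule has_field_derivative_at_within,
          rule has_real_derivative_divide_sqrt_diff_arsinh) simp
  qed
  then show ?thesis by (simp add: f_def)
qed

text \<open>At \<open>x = 1\<close> this gives \<open>1 / arsinh 1 > 1\<close>, which makes the
  extremal constant of the lower bound positive.\<close>

lemma arsinh_less_self:
  fixes x :: real
  assumes "x > 0"
  shows "arsinh x < x"
proof -
  have "arsinh x - x < arsinh 0 - (0::real)"
  proof (rule DERIV_neg_imp_decreasing_open[OF assms])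
    fix z :: real assume "0 < z" "z < x"
    then have "sqrt (z\<^sup>2 + 1) > 1" by simp
    then have "1 / sqrt (z\<^sup>2 + 1) < 1" by (subst divide_less_eq_1_pos) linarith+
    then show "\<exists>y. ((\<lambda>z. arsinh z - z) has_real_derivative y) (at z) \<and> y < 0"
      by (intro exI[of _ "1 / sqrt (z\<^sup>2 + 1) - 1"])
         (auto intro!: derivative_eq_intros)
  qed (auto intro!: continuous_intros)
  then show ?thesis by simp
qed

text \<open>
  The difference of the two sides vanishes at 0 and at 1, and its derivative can change sign only
  from positive to negative because \<open>1 - 3u - 3u\<^sup>2y - u\<^sup>3y\<^sup>2\<close> is decreasing in \<open>y\<close>.
\<close>

lemma arsinh_less_divide_sqrt:
  fixes u x :: real
  assumes u: "u > 0" "1 / sqrt (1 + u) = arsinh 1" and x: "0 < x" "x < 1"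
  shows "arsinh x < x / sqrt (1 + u * x\<^sup>2)"
proof (rule ccontr)
  assume not_less: "\<not> ?thesis"
  define f where "f = (\<lambda>z::real. z / sqrt (1 + u * z\<^sup>2) - arsinh z)"
  define f' where "f' = (\<lambda>z::real. 1 / sqrt (1 + u * z\<^sup>2) ^ 3 - 1 / sqrt (z\<^sup>2 + 1))"
  define G where "G = (\<lambda>y. 1 - 3 * u - 3 * u\<^sup>2 * y - u ^ 3 * y\<^sup>2)"
  have deriv: "(f has_real_derivative f' z) (at z)" for z
    unfolding f_def f'_def using u(1) by (intro has_real_derivative_divide_sqrt_diff_arsinh) simp
  have f: "f 0 = 0" "f 1 = 0" "f x \<le> 0" using u(2) not_less by (simp_all add: f_def)
  have sign: "f' z < 0 \<longleftrightarrow> G (z\<^sup>2) < 0" "f' z > 0 \<longleftrightarrow> G (z\<^sup>2) > 0" if "z > 0" for z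
  proof -
    have pos: "z\<^sup>2 + 1 > 0" "1 + u * z\<^sup>2 > 0" using u(1) by (simp_all add: add_nonneg_pos add_pos_nonneg)
    have eq: "(1 + u * z\<^sup>2) ^ 3 = z\<^sup>2 + 1 - z\<^sup>2 * G (z\<^sup>2)"
      by (simp add: G_def power2_eq_square power3_eq_cube algebra_simps)
    show "f' z < 0 \<longleftrightarrow> G (z\<^sup>2) < 0" "f' z > 0 \<longleftrightarrow> G (z\<^sup>2) > 0"
      using inverse_sqrt_cube_less_iff[OF pos] that unfolding f'_def eq
      by (simp_all add: mult_less_0_iff zero_less_mult_iff)
  qed
  \<comment> \<open>Since \<open>f\<close> vanishes at 0 and 1 and \<open>f x \<le> 0\<close>, its
    mean slope is nonpositive on \<open>{0..x}\<close> and nonnegative on \<open>{x..1}\<close>. The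
    intermediate points \<open>c < d\<close> then give
    \<open>G (c\<^sup>2) \<le> 0 \<le> G (d\<^sup>2)\<close>, against the strict decrease of
    \<open>G\<close>.\<close>
  obtain c where c: "0 < c" "c < x" "f x - f 0 = (x - 0) * f' c"
    using MVT2[of 0 x f f'] x deriv by blast
  obtain d where d: "x < d" "d < 1" "f 1 - f x = (1 - x) * f' d"
    using MVT2[of x 1 f f'] x deriv by blast
  have "x * f' c \<le> 0" using c f by simp
  then have "f' c \<le> 0" using x by (simp add: mult_le_0_iff)
  then have "G (c\<^sup>2) \<le> 0" using sign(2)[of c] c by simp
  have "(1 - x) * f' d \<ge> 0" using d f by simp
  then have "f' d \<ge> 0" using x by (simp add: zero_le_mult_iff)
  then have "G (d\<^sup>2) \<ge> 0" using sign(1)[of d] d x by simp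
  moreover have "G (d\<^sup>2) < G (c\<^sup>2)"
  proof -
    have cd: "c\<^sup>2 < d\<^sup>2" using c d by (intro power_strict_mono) auto
    then have "(c\<^sup>2)\<^sup>2 < (d\<^sup>2)\<^sup>2" by (rule power_strict_mono) simp_all
    with cd have "3 * u\<^sup>2 * c\<^sup>2 < 3 * u\<^sup>2 * d\<^sup>2" "u ^ 3 * (c\<^sup>2)\<^sup>2 < u ^ 3 * (d\<^sup>2)\<^sup>2"
      using u(1) by simp_all
    then show ?thesis by (simp add: G_def)
  qed
  ultimately show False using \<open>G (c\<^sup>2) \<le> 0\<close> by simp
qed

section \<open>Convexity bounds for real powers\<close>

lemma powr_interpolate_le:
  fixes q s w :: real
  assumes "q \<ge> 1" "w \<ge> 0" "0 \<le> s" "s \<le> 1"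
  shows "(1 + w * s) powr q \<le> 1 + s * ((1 + w) powr q - 1)"
proof -
  \<comment> \<open>The point \<open>1 + w * s\<close> divides the segment from \<open>1\<close> to
    \<open>1 + w\<close> with weight \<open>s\<close>, so the power lies below its chord.\<close>
  have "((1 - s) *\<^sub>R 1 + s *\<^sub>R (1 + w)) powr q \<le> (1 - s) * 1 powr q + s * (1 + w) powr q"
    using assms by (intro convex_onD[OF powr_convex]) auto
  then show ?thesis by (simp add: algebra_simps)
qed

text \<open>Weighted AM-GM for \<open>1 + q * y\<close> and \<open>1\<close> with weights
  \<open>1 / q\<close> and \<open>1 - 1 / q\<close> has mean \<open>1 + y\<close>; raising to the
  power \<open>q\<close> gives the claim.\<close>

lemma Bernoulli_inequality_powr:
  fixes q y :: real
  assumes "q \<ge> 1" "y \<ge> 0"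
  shows "1 + q * y \<le> (1 + y) powr q"
proof -
  have "(1 + q * y) powr (1 / q) * 1 powr (1 - 1 / q) \<le> 1 / q * (1 + q * y) + (1 - 1 / q) * 1"
    using assms by (intro Youngs_inequality_0) (auto intro: add_pos_nonneg)
  also have "\<dots> = 1 + y" using assms by (simp add: field_simps)
  finally have "((1 + q * y) powr (1 / q)) powr q \<le> (1 + y) powr q"
    using assms by (intro powr_mono2) auto
  then show ?thesis using assms by (simp add: powr_powr)
qed

section \<open>Sharp constants for general exponents\<close>

lemma powr_less_divide_arsinh_iff:
  fixes u p :: real
  assumes u: "u > 0" and p: "p \<ge> 1/2"
  shows "(\<forall>x. 0 < x \<and> x < 1 \<longrightarrow> (1 + u * x\<^sup>2) powr p < x / arsinh x) \<longleftrightarrow>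
         (1 + u) powr p \<le> 1 / arsinh 1" (is "?L \<longleftrightarrow> ?R")
proof
  assume L: ?L
  show ?R
  proof (rule tendsto_le)
    show "((\<lambda>x. (1 + u * x\<^sup>2) powr p) \<longlongrightarrow> (1 + u) powr p) (at_left 1)"
      by (rule tendsto_eq_intros refl | use u in simp)+
    show "((\<lambda>x::real. x / arsinh x) \<longlongrightarrow> 1 / arsinh 1) (at_left 1)"
      by (intro tendsto_intros) auto
    show "\<forall>\<^sub>F x in at_left 1. (1 + u * x\<^sup>2) powr p \<le> x / arsinh x"
      using eventually_at_left_real[of 0 "1::real"] L by (auto elim!: eventually_mono intro: less_imp_le)
  qed simp
next
  assume R: ?R
  \<comment> \<open>The value of \<open>x / arsinh x\<close> at 1 is \<open>m\<close>. Both
    \<open>w\<close> and \<open>U\<close> are the constants for which equality holds there: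
    \<open>w\<close> for exponent \<open>p\<close>, \<open>U\<close> for exponent 1/2.\<close>
  define m :: real where "m = 1 / arsinh 1"
  define U where "U = m\<^sup>2 - 1"
  define w where "w = m powr (1 / p) - 1"
  have m: "m > 1" using arsinh_less_self[of 1] by (simp add: m_def)
  then have m2: "m\<^sup>2 > 1" by (simp add: one_less_power)
  have w: "u \<le> w"
  proof -
    have "((1 + u) powr p) powr (1 / p) \<le> m powr (1 / p)"
      using R p by (intro powr_mono2) (auto simp: m_def)
    then show ?thesis using u p by (simp add: w_def powr_powr)
  qed
  have wU: "(1 + w) powr (2 * p) - 1 = U"
    using m p by (simp add: w_def U_def powr_powr)
  have U: "1 / sqrt (1 + U) = arsinh 1" using m by (simp add: U_def) (simp add: m_def)
  show ?L
  proof (intro allI impI)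
    fix x :: real assume x: "0 < x \<and> x < 1"
    then have ar: "arsinh x > 0" by simp
    have x2: "x\<^sup>2 \<le> 1" using x by (simp add: power_le_one)
    have "(1 + u * x\<^sup>2) powr p \<le> (1 + w * x\<^sup>2) powr p"
      using u w p by (intro powr_mono2) (auto intro!: mult_right_mono add_nonneg_nonneg)
    also have "\<dots> = sqrt ((1 + w * x\<^sup>2) powr (2 * p))"
      using u w by (simp add: powr_half_sqrt[symmetric] powr_powr)
    \<comment> \<open>The chord bound in \<open>x\<^sup>2\<close> with exponent
      \<open>2 * p \<ge> 1\<close>; its slope is exactly \<open>U\<close>.\<close>
    also have "\<dots> \<le> sqrt (1 + U * x\<^sup>2)"
      using powr_interpolate_le[of "2 * p" w "x\<^sup>2"] p u w x2 wU by (simp add: mult.commute)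
    also have "\<dots> < x / arsinh x"
    proof -
      have "sqrt (1 + U * x\<^sup>2) > 0" using m2 by (simp add: U_def add_pos_nonneg)
      moreover have "arsinh x < x / sqrt (1 + U * x\<^sup>2)"
        using m2 U x by (intro arsinh_less_divide_sqrt) (auto simp: U_def)
      ultimately show ?thesis using ar by (simp add: field_simps)
    qed
    finally show "(1 + u * x\<^sup>2) powr p < x / arsinh x" .
  qed
qed

lemma divide_arsinh_less_powr_iff:
  fixes u p :: real
  assumes u: "u > 0" and p: "p \<ge> 1/2"
  shows "(\<forall>x. 0 < x \<and> x < 1 \<longrightarrow> x / arsinh x < (1 + u * x\<^sup>2) powr p) \<longleftrightarrow> 1 \<le> 6 * p * u"
    (is "?L \<longleftrightarrow> ?R")
proof
  assume L: ?L
  \<comment> \<open>Near 0, \<open>x / arsinh x = 1 + x\<^sup>2 / 6 + ...\<close> and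
    \<open>(1 + u * x\<^sup>2) powr p = 1 + p * u * x\<^sup>2 + ...\<close>; the limit compares the
    quadratic coefficients.\<close>
  have "((\<lambda>x. ((1 + u * x\<^sup>2) powr p - x / arsinh x) / x\<^sup>2) \<longlongrightarrow> p * u - 1/6) (at_right 0)"
    unfolding arsinh_def using u p by real_asymp
  moreover have "\<forall>\<^sub>F x in at_right 0. ((1 + u * x\<^sup>2) powr p - x / arsinh x) / x\<^sup>2 \<ge> 0"
    using eventually_at_right_real[of 0 "1::real"] L
    by (auto elim!: eventually_mono intro!: less_imp_le)
  ultimately have "p * u - 1/6 \<ge> 0"
    by (intro tendsto_lowerbound) auto
  then show ?R by simp
next
  assume R: ?R
  show ?L
  proof (intro allI impI)
    fix x :: real assume x: "0 < x \<and> x < 1"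
    then have ar: "arsinh x > 0" by simp
    have x2: "x\<^sup>2 \<ge> 0" "x\<^sup>2 \<le> 1" using x by (simp_all add: power_le_one)
    have "x / arsinh x < sqrt (1 + 1/3 * x\<^sup>2)"
    proof -
      have "sqrt (1 + 1/3 * x\<^sup>2) > 0" by (simp add: add_pos_nonneg)
      then show ?thesis
        using divide_sqrt_less_arsinh[of x] x ar by (simp add: field_simps)
    qed
    also have "\<dots> \<le> sqrt ((1 + u * x\<^sup>2) powr (2 * p))"
    proof -
      have "1/3 * x\<^sup>2 \<le> (2 * p * u) * x\<^sup>2" using R by (intro mult_right_mono) auto
      also have "\<dots> = 2 * p * (u * x\<^sup>2)" by simp
      also have "1 + \<dots> \<le> (1 + u * x\<^sup>2) powr (2 * p)"
        using u p x2 by (intro Bernoulli_inequality_powr) auto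
      finally show ?thesis by simp
    qed
    also have "\<dots> = (1 + u * x\<^sup>2) powr p"
      using u by (simp add: powr_half_sqrt[symmetric] powr_powr)
    finally show "x / arsinh x < (1 + u * x\<^sup>2) powr p" .
  qed
qed

section \<open>Reduction of the means to one variable\<close>

lemma neuman_sandor_mean_eq:
  fixes a b :: real
  assumes "a > 0" "b > 0"
  defines "x \<equiv> \<bar>a - b\<bar> / (a + b)"
  shows "neuman_sandor_mean a b = arithmetic_mean a b * (x / arsinh x)"
proof (cases "a \<ge> b")
  case True
  then show ?thesis using assms by (simp add: neuman_sandor_mean_def arithmetic_mean_def)
next
  case False
  \<comment> \<open>As \<open>arsinh\<close> is odd, both signs cancel in the quotient.\<close>
  then have "(a - b) / (a + b) = - x" by (simp add: x_def minus_divide_left)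
  moreover have "a - b = - x * (a + b)" using calculation assms by (simp add: field_simps)
  ultimately show ?thesis by (simp add: neuman_sandor_mean_def arithmetic_mean_def)
qed

text \<open>The two arguments of the contra-harmonic mean add up to \<open>a + b\<close> and differ
  by \<open>(2 * t - 1) * (a - b)\<close>, so that mean is the arithmetic mean times
  \<open>1 + (2 * t - 1)\<^sup>2 * x\<^sup>2\<close>. The exponents \<open>p\<close> and
  \<open>1 - p\<close> of the arithmetic mean then add to 1.\<close>

lemma Q_mean_eq:
  fixes a b t p :: real
  assumes "a > 0" "b > 0"
  defines "x \<equiv> \<bar>a - b\<bar> / (a + b)"
  shows "Q_mean t p a b = arithmetic_mean a b * (1 + (2 * t - 1)\<^sup>2 * x\<^sup>2) powr p"
proof -
  let ?A = "arithmetic_mean a b" and ?E = "1 + (2 * t - 1)\<^sup>2 * x\<^sup>2"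
  have A: "?A > 0" using assms by (simp add: arithmetic_mean_def)
  let ?d = "(2 * t - 1)\<^sup>2 * (a - b)\<^sup>2"
  have "contraharmonic_mean (t * a + (1 - t) * b) (t * b + (1 - t) * a) =
      ((t * a + (1 - t) * b)\<^sup>2 + (t * b + (1 - t) * a)\<^sup>2) / (a + b)"
    by (simp add: contraharmonic_mean_def algebra_simps)
  also have "(t * a + (1 - t) * b)\<^sup>2 + (t * b + (1 - t) * a)\<^sup>2 = ((a + b)\<^sup>2 + ?d) / 2"
    by (simp add: power2_eq_square field_simps)
  also have "(a - b)\<^sup>2 = x\<^sup>2 * (a + b)\<^sup>2"
    using assms(1,2) by (simp add: x_def power_divide)
  also have "((a + b)\<^sup>2 + (2 * t - 1)\<^sup>2 * (x\<^sup>2 * (a + b)\<^sup>2)) / 2 / (a + b) = ?A * ?E"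
    using assms(1,2) unfolding arithmetic_mean_def
    by (simp add: divide_eq_eq) (simp add: power2_eq_square algebra_simps)
  finally have "Q_mean t p a b = ?A powr p * ?E powr p * ?A powr (1 - p)"
    using A by (simp add: Q_mean_def powr_mult)
  also have "\<dots> = ?A powr (p + (1 - p)) * ?E powr p"
    by (simp only: powr_add mult_ac)
  finally show ?thesis using A by simp
qed

theorem theorem1p1:
  fixes t1 t2 p :: real
  assumes "t1 \<in> {1/2<..<1}" and "t2 \<in> {1/2<..<1}" and "p \<in> {1/2..}"
  shows "(\<forall>a b. a > 0 \<and> b > 0 \<and> a \<noteq> b \<longrightarrow>
            Q_mean t1 p a b < neuman_sandor_mean a b \<and>
            neuman_sandor_mean a b < Q_mean t2 p a b)
         \<longleftrightarrow>
         t1 \<le> 1/2 * (1 + sqrt ((1 / t_star) powr (1 / p) - 1)) \<and>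
         t2 \<ge> 1/2 * (1 + 1 / sqrt (6 * p))" (is "?bounds \<longleftrightarrow> _")
proof -
  define u1 u2 where "u1 = (2 * t1 - 1)\<^sup>2" and "u2 = (2 * t2 - 1)\<^sup>2"
  have p: "p \<ge> 1/2" and u: "u1 > 0" "u2 > 0" using assms by (auto simp: u1_def u2_def)
  have affine: "2 * t - 1 \<le> r \<longleftrightarrow> t \<le> 1/2 * (1 + r)" for t r :: real
    by (simp add: field_simps)
  have "?bounds \<longleftrightarrow> (\<forall>x. 0 < x \<and> x < 1 \<longrightarrow>
      (1 + u1 * x\<^sup>2) powr p < x / arsinh x \<and> x / arsinh x < (1 + u2 * x\<^sup>2) powr p)" (is "_ \<longleftrightarrow> ?R")
  proof
    assume L: ?bounds
    show ?R
    proof (intro allI impI)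
      fix x :: real assume x: "0 < x \<and> x < 1"
      \<comment> \<open>The pair \<open>1 + x\<close>, \<open>1 - x\<close> realises every
        \<open>x\<close> in (0, 1) with arithmetic mean 1.\<close>
      have eq: "\<bar>(1 + x) - (1 - x)\<bar> / ((1 + x) + (1 - x)) = x" "arithmetic_mean (1 + x) (1 - x) = 1"
        using x by (simp_all add: arithmetic_mean_def)
      show "(1 + u1 * x\<^sup>2) powr p < x / arsinh x \<and> x / arsinh x < (1 + u2 * x\<^sup>2) powr p"
        using L[rule_format, of "1 + x" "1 - x"] x
          neuman_sandor_mean_eq[of "1 + x" "1 - x"] Q_mean_eq[of "1 + x" "1 - x"]
        unfolding eq by (simp add: u1_def u2_def)
    qed
  next
    assume R: ?R
    show ?bounds
    proof (intro allI impI)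
      fix a b :: real assume ab: "a > 0 \<and> b > 0 \<and> a \<noteq> b"
      then have "0 < \<bar>a - b\<bar> / (a + b) \<and> \<bar>a - b\<bar> / (a + b) < 1" "arithmetic_mean a b > 0"
        by (auto simp: arithmetic_mean_def field_simps)
      moreover note R[rule_format, OF this(1)]
      ultimately show "Q_mean t1 p a b < neuman_sandor_mean a b \<and> neuman_sandor_mean a b < Q_mean t2 p a b"
        using ab by (simp only: neuman_sandor_mean_eq Q_mean_eq u1_def u2_def mult_less_cancel_left_pos)
    qed
  qed
  also have "\<dots> \<longleftrightarrow> (1 + u1) powr p \<le> 1 / arsinh 1 \<and> 1 \<le> 6 * p * u2"
    unfolding powr_less_divide_arsinh_iff[OF u(1) p, symmetric]
      divide_arsinh_less_powr_iff[OF u(2) p, symmetric] by blast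
  also have "(1 + u1) powr p \<le> 1 / arsinh 1 \<longleftrightarrow>
      t1 \<le> 1/2 * (1 + sqrt ((1 / t_star) powr (1 / p) - 1))"
  proof -
    have t: "t_star = arsinh 1" by (simp add: t_star_def arsinh_real_def)
    have pos: "t_star > 0" by (simp add: t)
    have "(1 + u1) powr p \<le> 1 / t_star \<longleftrightarrow> 1 + u1 \<le> (1 / t_star) powr (1 / p)"
    proof
      assume "(1 + u1) powr p \<le> 1 / t_star"
      then have "((1 + u1) powr p) powr (1 / p) \<le> (1 / t_star) powr (1 / p)"
        using p by (intro powr_mono2) auto
      then show "1 + u1 \<le> (1 / t_star) powr (1 / p)" using p u by (simp add: powr_powr)
    next
      assume "1 + u1 \<le> (1 / t_star) powr (1 / p)"
      then have "(1 + u1) powr p \<le> ((1 / t_star) powr (1 / p)) powr p"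
        using p u by (intro powr_mono2) auto
      then show "(1 + u1) powr p \<le> 1 / t_star" using p pos by (simp add: powr_powr)
    qed
    \<comment> \<open>In HOL \<open>sqrt\<close> is extended to negative reals as an odd function
      and is strictly increasing everywhere, so no sign condition on the radicand arises.\<close>
    also have "\<dots> \<longleftrightarrow> sqrt u1 \<le> sqrt ((1 / t_star) powr (1 / p) - 1)"
      unfolding real_sqrt_le_iff by (rule iffI) linarith+
    also have "sqrt u1 = 2 * t1 - 1" using assms by (simp add: u1_def)
    also have "2 * t1 - 1 \<le> sqrt ((1 / t_star) powr (1 / p) - 1) \<longleftrightarrow>
        t1 \<le> 1/2 * (1 + sqrt ((1 / t_star) powr (1 / p) - 1))"
      by (rule affine)
    finally show ?thesis unfolding t .
  qed
  also have "1 \<le> 6 * p * u2 \<longleftrightarrow> t2 \<ge> 1/2 * (1 + 1 / sqrt (6 * p))"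
  proof -
    have "1 \<le> 6 * p * u2 \<longleftrightarrow> 1 / (6 * p) \<le> u2" using p by (simp add: field_simps)
    also have "\<dots> \<longleftrightarrow> 1 / sqrt (6 * p) \<le> sqrt u2"
      by (metis real_sqrt_divide real_sqrt_le_iff real_sqrt_one)
    also have "sqrt u2 = 2 * t2 - 1" using assms by (simp add: u2_def)
    also have "1 / sqrt (6 * p) \<le> 2 * t2 - 1 \<longleftrightarrow> t2 \<ge> 1/2 * (1 + 1 / sqrt (6 * p))"
      by argo
    finally show ?thesis .
  qed
  finally show ?thesis .
qed

end
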